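(* Let $\mathcal A,\mathcal E$ be finite sets, $P_{A,E}$ a sub-distribution on $\mathcal A\times\mathcal E$, $\mathsf M$ a positive integer and $\varepsilon>0$. Then $$\Delta_{d,2}(\mathsf M,\varepsilon|P_{A,E})\le(2+\sqrt\varepsilon)\,\mathsf M^{s}e^{-sH^{\uparrow}_{\frac1{1-s}}(A|E|P_{A,E})}$$ holds for every $s\in(0,1/2]$.
   Context: Logarithms are natural. A sub-distribution is a nonnegative function with total sum $\le1$; $\|\cdot\|_1$ is the sum of absolute values. For $u>0$, $H_{1+u}^\uparrow(A|E|P_{A,E})=-\frac{1+u}{u}\log\sum_e\bigl(\sum_aP_{A,E}(a,e)^{1+u}\bigr)^{\frac1{1+u}}$, so that $e^{-sH^\uparrow_{1/(1-s)}(A|E|P_{A,E})}=\sum_e\bigl(\sum_aP_{A,E}(a,e)^{1/(1-s)}\bigr)^{1-s}$. $H_2(A|E|P\|Q_E)=-\log\sum_{a,e}P(a,e)^2Q_E(e)^{-1}$ (with $0/0=0$ and value $-\infty$ if $P(a,e)>0=Q_E(e)$ for some $(a,e)$). With minima understood as infima, $$\Delta_{d,2}(\mathsf M,\varepsilon|P_{A,E})=\min_{Q_E}\min_{P'_{A,E}}\Bigl[2\|P_{A,E}-P'_{A,E}\|_1+\sqrt\varepsilon\,\mathsf M^{1/2}e^{-\frac12H_2(A|E|P'_{A,E}\|Q_E)}\Bigr],$$ where $Q_E$ ranges over probability distributions on $\mathcal E$ and $P'_{A,E}$ over sub-distributions on $\mathcal A\times\mathcal E$. *)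

theory Defs
  imports "HOL-Analysis.Analysis"
begin

text \<open>
  Entropies are extended reals: they take the value \<open>\<infinity>\<close> on the zero sub-distribution, and the
  collision entropy relative to \<open>Q\<close> can be \<open>-\<infinity>\<close>. The real \<open>ln\<close> and \<open>exp\<close> are therefore
  extended continuously, \<open>ln\<close> to \<open>[0, \<infinity>]\<close> and \<open>exp\<close> to \<open>[-\<infinity>, \<infinity>]\<close>; the value of \<open>ln_e\<close> on
  negative arguments is irrelevant.
\<close>

definition ln_e :: "ereal \<Rightarrow> ereal" where
  "ln_e x = (case x of ereal r \<Rightarrow> (if r \<le> 0 then - \<infinity> else ereal (ln r)) | PInfty \<Rightarrow> \<infinity> | MInfty \<Rightarrow> - \<infinity>)"

definition exp_e :: "ereal \<Rightarrow> ereal" where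
  "exp_e x = (case x of ereal r \<Rightarrow> ereal (exp r) | PInfty \<Rightarrow> \<infinity> | MInfty \<Rightarrow> 0)"

text \<open>Only the values on \<open>S\<close> matter; functions are not constrained outside \<open>S\<close>.\<close>

definition sub_distributions :: "'x set \<Rightarrow> ('x \<Rightarrow> real) set" where
  "sub_distributions S = {p. (\<forall>x\<in>S. 0 \<le> p x) \<and> (\<Sum>x\<in>S. p x) \<le> 1}"

definition prob_distributions :: "'x set \<Rightarrow> ('x \<Rightarrow> real) set" where
  "prob_distributions S = {p. (\<forall>x\<in>S. 0 \<le> p x) \<and> (\<Sum>x\<in>S. p x) = 1}"

definition l1_norm_on :: "'x set \<Rightarrow> ('x \<Rightarrow> real) \<Rightarrow> real" where
  "l1_norm_on S f = (\<Sum>x\<in>S. \<bar>f x\<bar>)"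

text \<open>The argument \<open>\<alpha>\<close> is the order \<open>1 + u\<close> of \<open>H\<^sup>\<up>\<close>, meaningful for \<open>\<alpha> > 1\<close>.\<close>

definition H_up :: "real \<Rightarrow> 'a set \<Rightarrow> 'e set \<Rightarrow> ('a \<times> 'e \<Rightarrow> real) \<Rightarrow> ereal" where
  "H_up \<alpha> A E P =
     (let u = \<alpha> - 1 in
      ereal (- ((1 + u) / u)) *
        ln_e (ereal (\<Sum>e\<in>E. (\<Sum>a\<in>A. P (a, e) powr (1 + u)) powr (1 / (1 + u)))))"

text \<open>
  Division is taken in \<^typ>\<open>ereal\<close>, where \<open>0 / 0 = 0\<close> and \<open>x / 0 = \<infinity>\<close> for \<open>x > 0\<close>. So
  pairs with \<open>P (a, e) = 0 = Q e\<close> contribute nothing, and a pair with \<open>P (a, e) > 0 = Q e\<close>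
  makes \<open>H_2\<close> equal to \<open>-\<infinity>\<close>.
\<close>

definition H_2 :: "'a set \<Rightarrow> 'e set \<Rightarrow> ('a \<times> 'e \<Rightarrow> real) \<Rightarrow> ('e \<Rightarrow> real) \<Rightarrow> ereal" where
  "H_2 A E P Q = - ln_e (\<Sum>(a, e)\<in>A \<times> E. ereal ((P (a, e))\<^sup>2) / ereal (Q e))"

definition Delta_d2 :: "'a set \<Rightarrow> 'e set \<Rightarrow> nat \<Rightarrow> real \<Rightarrow> ('a \<times> 'e \<Rightarrow> real) \<Rightarrow> ereal" where
  "Delta_d2 A E M \<epsilon> P =
     (INF Q\<in>prob_distributions E. INF P'\<in>sub_distributions (A \<times> E).
        ereal (2 * l1_norm_on (A \<times> E) (\<lambda>x. P x - P' x))
        + ereal (sqrt \<epsilon> * real M powr (1/2)) * exp_e (ereal (- (1/2)) * H_2 A E P' Q))"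

lemma exp_e_H_up:
  fixes s :: real
  assumes "0 < s" "s < 1"
  shows "exp_e (ereal (- s) * H_up (1 / (1 - s)) A E P) =
    ereal (\<Sum>e\<in>E. (\<Sum>a\<in>A. P (a, e) powr (1 / (1 - s))) powr (1 - s))"
proof -
  define S where "S = (\<Sum>e\<in>E. (\<Sum>a\<in>A. P (a, e) powr (1 / (1 - s))) powr (1 - s))"
  have S0: "S \<ge> 0"
    unfolding S_def by (intro sum_nonneg) simp
  have coeff: "(1 / (1 - s)) / (1 / (1 - s) - 1) = 1 / s"
    using assms by (simp add: divide_simps)
  have H: "H_up (1 / (1 - s)) A E P = ereal (- (1 / s)) * ln_e (ereal S)"
    using coeff by (simp add: H_up_def S_def Let_def)
  show ?thesis
  proof (cases "S = 0")
    case True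
    then show ?thesis using assms
      unfolding H S_def[symmetric] by (simp add: ln_e_def exp_e_def)
  next
    case False
    with S0 have "S > 0" by simp
    then show ?thesis using assms
      unfolding H S_def[symmetric] by (simp add: ln_e_def exp_e_def)
  qed
qed

lemma H_2_eq_minus_infinity:
  assumes "finite A" "finite E" "a \<in> A" "e \<in> E" "P (a, e) > 0" "Q e = 0"
  shows "H_2 A E P Q = - \<infinity>"
proof -
  have "\<exists>x\<in>A \<times> E. (case x of (a, e) \<Rightarrow> ereal ((P (a, e))\<^sup>2) / ereal (Q e)) = \<infinity>"
    using assms by (intro bexI[of _ "(a, e)"]) (auto simp: divide_ereal_def)
  then have "(\<Sum>(a, e)\<in>A \<times> E. ereal ((P (a, e))\<^sup>2) / ereal (Q e)) = \<infinity>"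
    using assms(1,2) by (simp add: sum_Pinfty)
  then show ?thesis by (simp add: H_2_def ln_e_def)
qed

end

theory Submission
  imports Defs
begin

text \<open>
  Put \<open>\<alpha> = 1 / (1 - s)\<close>, let \<open>T e\<close> be the \<open>\<alpha>\<close>-norm of \<open>P (\<cdot>, e)\<close>, and \<open>S = (\<Sum>e. T e)\<close>. Take
  \<open>Q = T / S\<close> and let \<open>P'\<close> be \<open>P\<close> truncated to the points where \<open>P (a, e) \<le> c T e\<close>.
  A Markov type estimate with the exponent \<open>\<alpha>\<close> gives
  \<open>\<parallel>P - P'\<parallel>\<^sub>1 \<le> c powr (1 - \<alpha>) * S\<close>, and \<open>P'\<^sup>2 \<le> P powr \<alpha> * (c T) powr (2 - \<alpha>)\<close> bounds the
  collision sum by \<open>c powr (2 - \<alpha>) * S\<^sup>2\<close>. The choice \<open>c = M powr - (1 - s)\<close> balances the two terms.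
\<close>

text \<open>The assumption \<open>zero\<close> excludes the value -\<infinity> of
  \<open>H_2\<close>, and 0 / 0 = 0 in both \<open>real\<close> and \<open>ereal\<close>, so the
  collision sum is a real number. If it vanishes, the entropy is \<infinity> and
  \<open>exp_e\<close> returns 0, in agreement with the square root.\<close>

lemma exp_e_H_2:
  assumes "finite A" "finite E"
    and "\<And>e. e \<in> E \<Longrightarrow> 0 \<le> Q e"
    and zero: "\<And>a e. a \<in> A \<Longrightarrow> e \<in> E \<Longrightarrow> Q e = 0 \<Longrightarrow> P (a, e) = 0"
  shows "exp_e (ereal (- (1/2)) * H_2 A E P Q)
    = ereal (sqrt (\<Sum>(a, e)\<in>A \<times> E. (P (a, e))\<^sup>2 / Q e))"
proof -
  define X where "X = (\<Sum>(a, e)\<in>A \<times> E. (P (a, e))\<^sup>2 / Q e)"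
  have X0: "X \<ge> 0"
    unfolding X_def using assms(3) by (auto intro!: sum_nonneg)
  have "(\<Sum>(a, e)\<in>A \<times> E. ereal ((P (a, e))\<^sup>2) / ereal (Q e))
      = (\<Sum>x\<in>A \<times> E. ereal (case x of (a, e) \<Rightarrow> (P (a, e))\<^sup>2 / Q e))"
    using zero by (intro sum.cong) (auto simp: divide_ereal_def divide_inverse)
  also have "\<dots> = ereal X"
    unfolding X_def by simp
  finally have H: "H_2 A E P Q = - ln_e (ereal X)"
    by (simp add: H_2_def)
  have "exp_e (ereal (- (1/2)) * - ln_e (ereal X)) = ereal (sqrt X)"
  proof (cases "X = 0")
    case False
    with X0 have "X > 0" by simp
    moreover from this have "exp (ln X / 2) = sqrt X"
      by (simp add: powr_half_sqrt[symmetric] powr_def)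
    ultimately show ?thesis by (simp add: ln_e_def exp_e_def)
  qed (simp add: ln_e_def exp_e_def)
  then show ?thesis
    unfolding H X_def .
qed

text \<open>An admissible pair bounds the double infimum; the support condition turns its objective
  into a real expression.\<close>

lemma Delta_d2_le:
  assumes "finite A" "finite E" "Q \<in> prob_distributions E" "P' \<in> sub_distributions (A \<times> E)"
    and "\<And>a e. a \<in> A \<Longrightarrow> e \<in> E \<Longrightarrow> Q e = 0 \<Longrightarrow> P' (a, e) = 0"
  shows "Delta_d2 A E M \<epsilon> P \<le> ereal (2 * l1_norm_on (A \<times> E) (\<lambda>x. P x - P' x)
    + sqrt \<epsilon> * real M powr (1/2) * sqrt (\<Sum>(a, e)\<in>A \<times> E. (P' (a, e))\<^sup>2 / Q e))"
proof -
  have "exp_e (ereal (- (1/2)) * H_2 A E P' Q)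
      = ereal (sqrt (\<Sum>(a, e)\<in>A \<times> E. (P' (a, e))\<^sup>2 / Q e))"
    using assms by (intro exp_e_H_2) (auto simp: prob_distributions_def)
  then show ?thesis
    unfolding Delta_d2_def using assms(3,4)
    by (intro INF_lower2[of Q] INF_lower2[of P']) simp_all
qed

text \<open>A removed point has f a > c T, so (f a / (c T)) powr (\<alpha> - 1) \<ge> 1 and f a
  \<le> f a powr \<alpha> * (c T) powr (1 - \<alpha>). Summing the factor f a powr \<alpha> gives T
  powr \<alpha>.\<close>

lemma truncation_tail_le:
  fixes f :: "'a \<Rightarrow> real"
  assumes "finite A" "1 < \<alpha>" "0 < c"
    and T: "T = (\<Sum>a\<in>A. f a powr \<alpha>) powr (1 / \<alpha>)"
  shows "(\<Sum>a\<in>A. \<bar>f a - (if f a \<le> c * T then f a else 0)\<bar>) \<le> c powr (1 - \<alpha>) * T"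
proof (cases "T = 0")
  case True
  then have "(\<Sum>a\<in>A. f a powr \<alpha>) = 0"
    using T by simp
  then have "\<forall>a\<in>A. f a = 0"
    using assms(1) by (simp add: sum_nonneg_eq_0_iff)
  then show ?thesis using True by simp
next
  case False
  then have Tpos: "T > 0" using T by simp
  have Ta: "T powr \<alpha> = (\<Sum>a\<in>A. f a powr \<alpha>)"
    using assms(2) by (simp add: T powr_powr sum_nonneg)
  have "\<bar>f a - (if f a \<le> c * T then f a else 0)\<bar> \<le> f a powr \<alpha> * (c * T) powr (1 - \<alpha>)"
    if "a \<in> A" for a
  proof (cases "f a \<le> c * T")
    case False
    have cT: "c * T > 0" using Tpos assms(3) by simp
    with False have fa: "f a > 0" by linarith
    have "f a = f a powr \<alpha> * f a powr (1 - \<alpha>)"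
      using fa by (simp flip: powr_add)
    also have "\<dots> \<le> f a powr \<alpha> * (c * T) powr (1 - \<alpha>)"
      using False cT assms(2) by (intro mult_left_mono powr_mono2') auto
    finally show ?thesis using False fa by simp
  qed simp
  then have "(\<Sum>a\<in>A. \<bar>f a - (if f a \<le> c * T then f a else 0)\<bar>)
      \<le> (\<Sum>a\<in>A. f a powr \<alpha> * (c * T) powr (1 - \<alpha>))"
    by (rule sum_mono)
  also have "\<dots> = c powr (1 - \<alpha>) * (T powr \<alpha> * T powr (1 - \<alpha>))"
    using Tpos assms(3) by (simp add: Ta powr_mult sum_distrib_right sum_distrib_left mult_ac)
  also have "T powr \<alpha> * T powr (1 - \<alpha>) = T"
    using Tpos by (simp flip: powr_add)
  finally show ?thesis .
qed

text \<open>At a kept point, split the square as f a powr \<alpha> * f a powr (2 - \<alpha>) and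
  bound the second factor by the threshold. Its exponent is nonnegative because \<alpha> \<le> 2,
  which is where s \<le> 1/2 enters the main proof.\<close>

lemma truncation_sum_squares_le:
  fixes f :: "'a \<Rightarrow> real"
  assumes "finite A" "\<And>a. a \<in> A \<Longrightarrow> 0 \<le> f a" "1 < \<alpha>" "\<alpha> \<le> 2" "0 < c"
    and T: "T = (\<Sum>a\<in>A. f a powr \<alpha>) powr (1 / \<alpha>)"
  shows "(\<Sum>a\<in>A. (if f a \<le> c * T then f a else 0)\<^sup>2) / T \<le> c powr (2 - \<alpha>) * T"
\<comment> \<open>For T = 0 both sides are 0, since division by zero yields 0.\<close>
proof (cases "T = 0")
  case False
  then have Tpos: "T > 0" using T by simp
  have Ta: "T powr \<alpha> = (\<Sum>a\<in>A. f a powr \<alpha>)"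
    using assms(3) by (simp add: T powr_powr sum_nonneg)
  have "(if f a \<le> c * T then f a else 0)\<^sup>2 \<le> f a powr \<alpha> * (c * T) powr (2 - \<alpha>)"
    if "a \<in> A" for a
  proof (cases "f a \<le> c * T \<and> f a \<noteq> 0")
    case True
    with assms(2)[OF that] have fa: "f a > 0" by simp
    have "(f a)\<^sup>2 = f a powr \<alpha> * f a powr (2 - \<alpha>)"
      using fa by (simp flip: powr_add add: powr_numeral)
    also have "\<dots> \<le> f a powr \<alpha> * (c * T) powr (2 - \<alpha>)"
      using True fa assms(4) by (intro mult_left_mono powr_mono2) auto
    finally show ?thesis using True by simp
  qed auto
  then have "(\<Sum>a\<in>A. (if f a \<le> c * T then f a else 0)\<^sup>2)
      \<le> (\<Sum>a\<in>A. f a powr \<alpha> * (c * T) powr (2 - \<alpha>))"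
    by (rule sum_mono)
  also have "\<dots> = c powr (2 - \<alpha>) * (T powr \<alpha> * T powr (2 - \<alpha>))"
    using Tpos assms(5) by (simp add: Ta powr_mult sum_distrib_right sum_distrib_left mult_ac)
  also have "T powr \<alpha> * T powr (2 - \<alpha>) = T\<^sup>2"
    using Tpos by (simp flip: powr_add add: powr_numeral)
  finally show ?thesis
    using Tpos by (simp add: divide_simps power2_eq_square mult_ac)
qed simp

theorem lemma22:
  fixes A :: "'a set" and E :: "'e set"
    and P :: "'a \<times> 'e \<Rightarrow> real" and M :: nat and \<epsilon> s :: real
  assumes "finite A" and "finite E" and "E \<noteq> {}"
    and "P \<in> sub_distributions (A \<times> E)"
    and "M > 0" and "\<epsilon> > 0"
    and "s \<in> {0<..1/2}"
  shows "Delta_d2 A E M \<epsilon> P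
    \<le> ereal ((2 + sqrt \<epsilon>) * real M powr s) * exp_e (ereal (- s) * H_up (1 / (1 - s)) A E P)"
proof -
  define \<alpha> where "\<alpha> = 1 / (1 - s)"
  define T where "T = (\<lambda>e. (\<Sum>a\<in>A. P (a, e) powr \<alpha>) powr (1 / \<alpha>))"
  define S where "S = (\<Sum>e\<in>E. T e)"
  define c where "c = real M powr (- (1 - s))"
  define P' where "P' = (\<lambda>(a, e). if P (a, e) \<le> c * T e then P (a, e) else 0)"
  \<comment> \<open>If S = 0, then P vanishes on A \<times> E and T / S is no distribution; the
    uniform one serves instead.\<close>
  define Q where "Q = (\<lambda>e. if S = 0 then 1 / real (card E) else T e / S)"
  have s: "0 < s" "s \<le> 1/2" using assms(7) by auto
  have \<alpha>: "1 < \<alpha>" "\<alpha> \<le> 2" using s by (auto simp: \<alpha>_def divide_simps)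
  have P0: "0 \<le> P (a, e)" if "a \<in> A" "e \<in> E" for a e
    using assms(4) that by (auto simp: sub_distributions_def)
  have T0: "0 \<le> T e" for e by (simp add: T_def)
  have S0: "0 \<le> S" by (simp add: S_def T0 sum_nonneg)
  have c: "c > 0" using assms(5) by (simp add: c_def)
  \<comment> \<open>Here \<alpha> - 1 = s / (1 - s) and 2 - \<alpha> = (1 - 2 s) / (1 - s).\<close>
  have "- (1 - s) * (1 - \<alpha>) = s" "- (1 - s) * (2 - \<alpha>) = 2 * s - 1"
    using s by (simp_all add: \<alpha>_def field_simps)
  then have c1: "c powr (1 - \<alpha>) = real M powr s"
    and c2: "c powr (2 - \<alpha>) = real M powr (2 * s - 1)"
    by (simp_all only: c_def powr_powr)
  have TS: "T e = 0" if "S = 0" "e \<in> E" for e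
    using that assms(2) T0 by (simp add: S_def sum_nonneg_eq_0_iff)
  have Q0: "0 \<le> Q e" for e
    using T0 S0 by (simp add: Q_def)
  have "sum Q E = 1"
  proof (cases "S = 0")
    case False
    then have "sum Q E = S / S"
      unfolding Q_def by (subst (2) S_def) (simp add: sum_divide_distrib)
    with False show ?thesis by simp
  qed (use assms(2,3) in \<open>simp add: Q_def\<close>)
  with Q0 have Qprob: "Q \<in> prob_distributions E"
    by (simp add: prob_distributions_def)
  have P'le: "0 \<le> P' x \<and> P' x \<le> P x" if "x \<in> A \<times> E" for x
    using that P0 by (auto simp: P'_def)
  have "sum P' (A \<times> E) \<le> sum P (A \<times> E)"
    using P'le by (intro sum_mono) auto
  then have P'sub: "P' \<in> sub_distributions (A \<times> E)"
    using P'le assms(4) by (auto simp: sub_distributions_def)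
  \<comment> \<open>The threshold c T e is then 0, so only zero values survive. With
    \<open>QT\<close> this gives the support condition of \<open>Delta_d2_le\<close>.\<close>
  have P'zero: "P' (a, e) = 0" if "a \<in> A" "e \<in> E" "T e = 0" for a e
    using P0[OF that(1,2)] that(3) by (auto simp: P'_def)
  have QT: "T e = 0" if "e \<in> E" "Q e = 0" for e
    using that assms(2,3) by (auto simp: Q_def split: if_splits)
  have "l1_norm_on (A \<times> E) (\<lambda>x. P x - P' x) = (\<Sum>e\<in>E. \<Sum>a\<in>A. \<bar>P (a, e) - P' (a, e)\<bar>)"
    unfolding l1_norm_on_def
    by (subst sum.swap) (simp add: sum.cartesian_product split_def)
  also have "\<dots> \<le> (\<Sum>e\<in>E. c powr (1 - \<alpha>) * T e)"
    unfolding P'_def prod.case using assms(1) P0 \<alpha> c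
    by (intro sum_mono truncation_tail_le) (auto simp: T_def)
  also have "\<dots> = real M powr s * S"
    by (simp add: S_def sum_distrib_left c1)
  finally have tail: "l1_norm_on (A \<times> E) (\<lambda>x. P x - P' x) \<le> real M powr s * S" .
  have "(\<Sum>(a, e)\<in>A \<times> E. (P' (a, e))\<^sup>2 / Q e) = (\<Sum>e\<in>E. \<Sum>a\<in>A. (P' (a, e))\<^sup>2 / Q e)"
    by (subst sum.swap) (simp add: sum.cartesian_product)
  \<comment> \<open>Dividing by T e / S releases the factor S. If S = 0, every T e and hence
    \<open>P'\<close> vanishes, and both sides are 0.\<close>
  also have "\<dots> = (\<Sum>e\<in>E. S * ((\<Sum>a\<in>A. (P' (a, e))\<^sup>2) / T e))"
    using TS P'zero
    by (intro sum.cong refl) (auto simp: Q_def sum_divide_distrib sum_distrib_left mult_ac)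
  also have "\<dots> \<le> (\<Sum>e\<in>E. S * (c powr (2 - \<alpha>) * T e))"
    unfolding P'_def prod.case using assms(1) P0 \<alpha> c S0
    by (intro sum_mono mult_left_mono truncation_sum_squares_le) (auto simp: T_def)
  also have "\<dots> = real M powr (2 * s - 1) * S\<^sup>2"
    by (simp add: c2 power2_eq_square mult_ac flip: sum_distrib_left sum_distrib_right S_def)
  finally have "sqrt (\<Sum>(a, e)\<in>A \<times> E. (P' (a, e))\<^sup>2 / Q e)
      \<le> sqrt (real M powr (2 * s - 1) * S\<^sup>2)"
    by (rule real_sqrt_le_mono)
  also have "\<dots> = real M powr (s - 1/2) * S"
    using S0 assms(5)
    by (simp add: real_sqrt_mult powr_half_sqrt[symmetric] powr_powr field_simps)
  finally have "real M powr (1/2) * sqrt (\<Sum>(a, e)\<in>A \<times> E. (P' (a, e))\<^sup>2 / Q e)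
      \<le> real M powr (1/2) * (real M powr (s - 1/2) * S)"
    by (rule mult_left_mono) simp
  also have "\<dots> = real M powr s * S"
    using assms(5) by (simp flip: powr_add mult.assoc)
  finally have head: "real M powr (1/2) * sqrt (\<Sum>(a, e)\<in>A \<times> E. (P' (a, e))\<^sup>2 / Q e)
      \<le> real M powr s * S" .
  have "Delta_d2 A E M \<epsilon> P \<le> ereal (2 * l1_norm_on (A \<times> E) (\<lambda>x. P x - P' x)
      + sqrt \<epsilon> * real M powr (1/2) * sqrt (\<Sum>(a, e)\<in>A \<times> E. (P' (a, e))\<^sup>2 / Q e))"
    using assms(1,2) Qprob P'sub QT P'zero by (intro Delta_d2_le) auto
  also have "\<dots> \<le> ereal ((2 + sqrt \<epsilon>) * real M powr s * S)"
    using add_mono[OF mult_left_mono[OF tail, of 2] mult_left_mono[OF head, of "sqrt \<epsilon>"]] assms(6)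
    by (simp add: distrib_right mult.assoc)
  \<comment> \<open>Since 1 / \<alpha> = 1 - s, the sum S is exactly the exponential of the entropy
    term.\<close>
  also have "\<dots> = ereal ((2 + sqrt \<epsilon>) * real M powr s)
      * exp_e (ereal (- s) * H_up (1 / (1 - s)) A E P)"
    using s by (simp add: exp_e_H_up S_def T_def \<alpha>_def)
  finally show ?thesis .
qed

end
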